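(* Let $(\mathcal G,\rho,\omega)$ be a symplectic Lie--Rinehart--Jacobi algebra over $A$ with extension $(\widehat{\mathcal G}_\omega,\widehat\rho)$ and canonical form $\eta$, and let $x\in\mathcal G$. There exists $f\in A$ such that $x+fe$ is a strict symmetry of $\eta$ if and only if $x\in\mathfrak{ham}$. When $x\in\mathfrak{ham}_{\mathrm{loc}}$, this is equivalent to $[i_x\omega]=0$ in $H^1_\rho(\mathcal G,A)$. When they exist, the strict lifts of $x$ (the elements $x+fe$, $f\in A$, that are strict symmetries of $\eta$) form an affine space over $H^0_\rho$.
   Context: $K$ is a commutative field of characteristic zero and $A$ a commutative unital $K$-algebra; $L_a$ is multiplication by $a$. $\mathrm{Diff}^1_K(A)$ is the set of $K$-linear $D:A\to A$ with $[[D,L_a],L_b]=0$ for all $a,b\in A$. A Lie--Rinehart--Jacobi (LRJ) algebra over $A$ is an $A$-module $\mathcal G$ with a $K$-Lie algebra structure and an $A$-linear map (anchor) $\rho:\mathcal G\to\mathrm{Diff}^1_K(A)$ which is a Lie algebra morphism and satisfies $[x,ay]=a[x,y]+(\rho(x)(a)-a\rho(x)(1_A))y$. $C^p_\rho(\mathcal G,A)=\mathrm{Alt}^p_A(\mathcal G,A)$ is the module of alternating $A$-multilinear maps $\mathcal G^p\to A$, with differential $(d_\rho\beta)(x_0,\dots,x_p)=\sum_i(-1)^i\rho(x_i)\beta(x_0,\dots,\widehat{x_i},\dots,x_p)+\sum_{i<j}(-1)^{i+j}\beta([x_i,x_j],x_0,\dots,\widehat{x_i},\dots,\widehat{x_j},\dots,x_p)$;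 in particular $(d_\rho a)(x)=\rho(x)(a)$. $H^p_\rho(\mathcal G,A)$ denotes its cohomology; $H^0_\rho=\{a\in A:\rho(x)(a)=0\ \forall x\in\mathcal G\}$. $i_x$ is the interior product and $\mathcal L^\rho_x=i_xd_\rho+d_\rho i_x$. The same notation is used for any LRJ algebra. A symplectic form on $(\mathcal G,\rho)$ is $\omega\in C^2_\rho(\mathcal G,A)$ with $d_\rho\omega=0$ and $\omega^\flat:\mathcal G\to\mathcal G^*=\mathrm{Hom}_A(\mathcal G,A)$, $x\mapsto i_x\omega$, an isomorphism of $A$-modules; $(\mathcal G,\rho,\omega)$ is then a symplectic LRJ algebra. The symplectic gradient $X_a\in\mathcal G$ of $a\in A$ is defined by $i_{X_a}\omega=d_\rho a$. $\mathfrak{ham}=\{X_a:a\in A\}$ (Hamiltonian elements) and $\mathfrak{ham}_{\mathrm{loc}}=\{x\in\mathcal G:\mathcal L^\rho_x\omega=0\}$ (locally Hamiltonian elements); since $d_\rho\omega=0$, $x\in\mathfrak{ham}_{\mathrm{loc}}$ iff $d_\rho(i_x\omega)=0$. The extension: $\widehat{\mathcal G}_\omega=\mathcal G\oplus Ae$ with $e$ generating a free summand of rank one, with bracket $[x+fe,y+ge]_\omega=[x,y]+(\rho(x)(g)-\rho(y)(f)+\omega(x,y))e$, anchor $\widehat\rho(x+fe)=\rho(x)$, projection $\pi(x+fe)=x$ and canonical form $\eta(x+fe)=f$. $(\widehat{\mathcal G}_\omega,\widehat\rho)$ is an LRJ algebra. An element $u\in\widehat{\mathcal G}_\omega$ is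 a strict symmetry of $\eta$ if $\mathcal L^{\widehat\rho}_u\eta=0$. *)

theory Defs
  imports Complex_Main "HOL-Library.Function_Algebras" "HOL-Library.Product_Plus"
begin

locale comm_unital_algebra = vector_space scaleK
  for scaleK :: "'k::field_char_0 \<Rightarrow> 'a::comm_ring_1 \<Rightarrow> 'a" +
  assumes scaleK_mult: "scaleK k (a * b) = scaleK k a * b"

definition commutator :: "('a::ab_group_add \<Rightarrow> 'a) \<Rightarrow> ('a \<Rightarrow> 'a) \<Rightarrow> 'a \<Rightarrow> 'a" where
  "commutator D E = (\<lambda>c. D (E c) - E (D c))"

definition Diff1 :: "('k::field_char_0 \<Rightarrow> 'a::comm_ring_1 \<Rightarrow> 'a) \<Rightarrow> ('a \<Rightarrow> 'a) set" where
  "Diff1 scaleK = {D. Vector_Spaces.linear scaleK scaleK D \<and>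
     (\<forall>a b. commutator (commutator D ((*) a)) ((*) b) = 0)}"

text \<open>The bracket of a Lie--Rinehart--Jacobi algebra is bilinear over \<open>K\<close>, which acts on the \<open>A\<close>-module through \<open>A\<close>.\<close>

definition restrict_scalars ::
  "('k \<Rightarrow> 'a::comm_ring_1 \<Rightarrow> 'a) \<Rightarrow> ('a \<Rightarrow> 'g \<Rightarrow> 'g) \<Rightarrow> 'k \<Rightarrow> 'g \<Rightarrow> 'g" where
  "restrict_scalars scaleK scaleG = (\<lambda>k x. scaleG (scaleK k 1) x)"

locale lrj_algebra = comm_unital_algebra scaleK + G: module scaleG
  for scaleK :: "'k::field_char_0 \<Rightarrow> 'a::comm_ring_1 \<Rightarrow> 'a"
  and scaleG :: "'a \<Rightarrow> 'g::ab_group_add \<Rightarrow> 'g" +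
  fixes bracket :: "'g \<Rightarrow> 'g \<Rightarrow> 'g"
    and anchor :: "'g \<Rightarrow> 'a \<Rightarrow> 'a"
  assumes bracket_linear_right:
      "Vector_Spaces.linear (restrict_scalars scaleK scaleG) (restrict_scalars scaleK scaleG)
         (\<lambda>y. bracket x y)"
    and bracket_linear_left:
      "Vector_Spaces.linear (restrict_scalars scaleK scaleG) (restrict_scalars scaleK scaleG)
         (\<lambda>x. bracket x y)"
    and bracket_self: "bracket x x = 0"
    and jacobi:
      "bracket x (bracket y z) + bracket y (bracket z x) + bracket z (bracket x y) = 0"
    and anchor_Diff1: "anchor x \<in> Diff1 scaleK"
    and anchor_add: "anchor (x + y) = anchor x + anchor y"
    and anchor_scale: "anchor (scaleG a x) = (\<lambda>b. a * anchor x b)"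
    and anchor_bracket: "anchor (bracket x y) = commutator (anchor x) (anchor y)"
    and leibniz:
      "bracket x (scaleG a y) = scaleG a (bracket x y) + scaleG (anchor x a - a * anchor x 1) y"

text \<open>
  A \<open>p\<close>-cochain is a function on lists of arguments, required to vanish on lists of length
  other than \<open>p\<close>, so that cochains are equal iff they agree on \<open>p\<close>-tuples.
  An element of \<open>A\<close> is identified with a \<open>0\<close>-cochain via \<open>const_cochain\<close>.
\<close>

definition cochains ::
  "('a::comm_ring_1 \<Rightarrow> 'g::ab_group_add \<Rightarrow> 'g) \<Rightarrow> nat \<Rightarrow> ('g list \<Rightarrow> 'a) set" where
  "cochains scaleG p = {\<beta>.
     (\<forall>xs. length xs \<noteq> p \<longrightarrow> \<beta> xs = 0) \<and>
     (\<forall>xs i. length xs = p \<longrightarrow> i < p \<longrightarrow> module_hom scaleG (*) (\<lambda>y. \<beta> (xs[i := y]))) \<and>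
     (\<forall>xs i j. length xs = p \<longrightarrow> i < j \<longrightarrow> j < p \<longrightarrow> xs ! i = xs ! j \<longrightarrow> \<beta> xs = 0)}"

definition const_cochain :: "'a::zero \<Rightarrow> 'g list \<Rightarrow> 'a" where
  "const_cochain a = (\<lambda>xs. if xs = [] then a else 0)"

definition omit :: "nat \<Rightarrow> 'g list \<Rightarrow> 'g list" where
  "omit i xs = take i xs @ drop (Suc i) xs"

definition differential ::
  "('g \<Rightarrow> 'g \<Rightarrow> 'g) \<Rightarrow> ('g \<Rightarrow> 'a \<Rightarrow> 'a) \<Rightarrow> ('g list \<Rightarrow> 'a) \<Rightarrow> 'g list \<Rightarrow> 'a::comm_ring_1" where
  "differential bracket anchor \<beta> = (\<lambda>xs.
     (\<Sum>i<length xs. (-1) ^ i * anchor (xs ! i) (\<beta> (omit i xs))) +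
     (\<Sum>j<length xs. \<Sum>i<j. (-1) ^ (i + j) *
        \<beta> (bracket (xs ! i) (xs ! j) # omit i (omit j xs))))"

definition interior_product :: "'g \<Rightarrow> ('g list \<Rightarrow> 'a) \<Rightarrow> 'g list \<Rightarrow> 'a" where
  "interior_product x \<beta> = (\<lambda>xs. \<beta> (x # xs))"

definition lie_derivative ::
  "('g \<Rightarrow> 'g \<Rightarrow> 'g) \<Rightarrow> ('g \<Rightarrow> 'a \<Rightarrow> 'a) \<Rightarrow> 'g \<Rightarrow> ('g list \<Rightarrow> 'a) \<Rightarrow> 'g list \<Rightarrow> 'a::comm_ring_1" where
  "lie_derivative bracket anchor x \<beta> =
     interior_product x (differential bracket anchor \<beta>) + differential bracket anchor (interior_product x \<beta>)"

definition cocycles ::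
  "('a::comm_ring_1 \<Rightarrow> 'g::ab_group_add \<Rightarrow> 'g) \<Rightarrow> ('g \<Rightarrow> 'g \<Rightarrow> 'g) \<Rightarrow> ('g \<Rightarrow> 'a \<Rightarrow> 'a) \<Rightarrow>
   nat \<Rightarrow> ('g list \<Rightarrow> 'a) set" where
  "cocycles scaleG bracket anchor p =
     {\<beta> \<in> cochains scaleG p. differential bracket anchor \<beta> = 0}"

definition coboundaries ::
  "('a::comm_ring_1 \<Rightarrow> 'g::ab_group_add \<Rightarrow> 'g) \<Rightarrow> ('g \<Rightarrow> 'g \<Rightarrow> 'g) \<Rightarrow> ('g \<Rightarrow> 'a \<Rightarrow> 'a) \<Rightarrow>
   nat \<Rightarrow> ('g list \<Rightarrow> 'a) set" where
  "coboundaries scaleG bracket anchor p =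
     (case p of 0 \<Rightarrow> {0} | Suc q \<Rightarrow> differential bracket anchor ` cochains scaleG q)"

definition cohomologous ::
  "('a::comm_ring_1 \<Rightarrow> 'g::ab_group_add \<Rightarrow> 'g) \<Rightarrow> ('g \<Rightarrow> 'g \<Rightarrow> 'g) \<Rightarrow> ('g \<Rightarrow> 'a \<Rightarrow> 'a) \<Rightarrow>
   nat \<Rightarrow> (('g list \<Rightarrow> 'a) \<times> ('g list \<Rightarrow> 'a)) set" where
  "cohomologous scaleG bracket anchor p =
     {(\<beta>, \<gamma>). \<beta> \<in> cocycles scaleG bracket anchor p \<and> \<gamma> \<in> cocycles scaleG bracket anchor p \<and>
        \<beta> - \<gamma> \<in> coboundaries scaleG bracket anchor p}"

definition cohomology ::
  "('a::comm_ring_1 \<Rightarrow> 'g::ab_group_add \<Rightarrow> 'g) \<Rightarrow> ('g \<Rightarrow> 'g \<Rightarrow> 'g) \<Rightarrow> ('g \<Rightarrow> 'a \<Rightarrow> 'a) \<Rightarrow>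
   nat \<Rightarrow> ('g list \<Rightarrow> 'a) set set" where
  "cohomology scaleG bracket anchor p =
     cocycles scaleG bracket anchor p // cohomologous scaleG bracket anchor p"

text \<open>
  The class of a cocycle; on a cochain that is not a cocycle this is the empty set, which is
  not an element of the cohomology.
\<close>

definition cohomology_class ::
  "('a::comm_ring_1 \<Rightarrow> 'g::ab_group_add \<Rightarrow> 'g) \<Rightarrow> ('g \<Rightarrow> 'g \<Rightarrow> 'g) \<Rightarrow> ('g \<Rightarrow> 'a \<Rightarrow> 'a) \<Rightarrow>
   nat \<Rightarrow> ('g list \<Rightarrow> 'a) \<Rightarrow> ('g list \<Rightarrow> 'a) set" where
  "cohomology_class scaleG bracket anchor p \<beta> = cohomologous scaleG bracket anchor p `` {\<beta>}"

definition H0 :: "('g \<Rightarrow> 'a \<Rightarrow> 'a) \<Rightarrow> 'a::zero set" where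
  "H0 anchor = {a. \<forall>x. anchor x a = 0}"

definition dual_module :: "('a::comm_ring_1 \<Rightarrow> 'g::ab_group_add \<Rightarrow> 'g) \<Rightarrow> ('g \<Rightarrow> 'a) set" where
  "dual_module scaleG = {\<phi>. module_hom scaleG (*) \<phi>}"

definition flat :: "('g list \<Rightarrow> 'a) \<Rightarrow> 'g \<Rightarrow> 'g \<Rightarrow> 'a" where
  "flat \<omega> x = (\<lambda>y. interior_product x \<omega> [y])"

locale symplectic_lrj_algebra = lrj_algebra scaleK scaleG bracket anchor
  for scaleK :: "'k::field_char_0 \<Rightarrow> 'a::comm_ring_1 \<Rightarrow> 'a"
  and scaleG :: "'a \<Rightarrow> 'g::ab_group_add \<Rightarrow> 'g"
  and bracket :: "'g \<Rightarrow> 'g \<Rightarrow> 'g"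
  and anchor :: "'g \<Rightarrow> 'a \<Rightarrow> 'a" +
  fixes \<omega> :: "'g list \<Rightarrow> 'a"
  assumes omega_cochain: "\<omega> \<in> cochains scaleG 2"
    and omega_closed: "differential bracket anchor \<omega> = 0"
    and flat_hom: "module_hom scaleG (\<lambda>a \<phi> y. a * \<phi> y) (flat \<omega>)"
    and flat_bij: "bij_betw (flat \<omega>) UNIV (dual_module scaleG)"

definition symplectic_gradient ::
  "('g \<Rightarrow> 'g \<Rightarrow> 'g) \<Rightarrow> ('g \<Rightarrow> 'a \<Rightarrow> 'a) \<Rightarrow> ('g list \<Rightarrow> 'a) \<Rightarrow> 'a::comm_ring_1 \<Rightarrow> 'g" where
  "symplectic_gradient bracket anchor \<omega> a =
     (THE x. interior_product x \<omega> = differential bracket anchor (const_cochain a))"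

definition ham ::
  "('g \<Rightarrow> 'g \<Rightarrow> 'g) \<Rightarrow> ('g \<Rightarrow> 'a \<Rightarrow> 'a) \<Rightarrow> ('g list \<Rightarrow> 'a::comm_ring_1) \<Rightarrow> 'g set" where
  "ham bracket anchor \<omega> = range (symplectic_gradient bracket anchor \<omega>)"

definition ham_loc ::
  "('g \<Rightarrow> 'g \<Rightarrow> 'g) \<Rightarrow> ('g \<Rightarrow> 'a \<Rightarrow> 'a) \<Rightarrow> ('g list \<Rightarrow> 'a::comm_ring_1) \<Rightarrow> 'g set" where
  "ham_loc bracket anchor \<omega> = {x. lie_derivative bracket anchor x \<omega> = 0}"

text \<open>The element \<open>x + f e\<close> of \<open>G \<oplus> A e\<close> is the pair \<open>(x, f)\<close>.\<close>

definition ext_scale :: "('a \<Rightarrow> 'g \<Rightarrow> 'g) \<Rightarrow> 'a \<Rightarrow> 'g \<times> 'a \<Rightarrow> 'g \<times> 'a::times" where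
  "ext_scale scaleG a u = (scaleG a (fst u), a * snd u)"

definition ext_generator :: "'g::zero \<times> 'a::one" where
  "ext_generator = (0, 1)"

definition ext_bracket ::
  "('g \<Rightarrow> 'g \<Rightarrow> 'g) \<Rightarrow> ('g \<Rightarrow> 'a \<Rightarrow> 'a) \<Rightarrow> ('g list \<Rightarrow> 'a) \<Rightarrow>
   'g \<times> 'a \<Rightarrow> 'g \<times> 'a \<Rightarrow> 'g \<times> 'a::comm_ring_1" where
  "ext_bracket bracket anchor \<omega> u v =
     (bracket (fst u) (fst v),
      anchor (fst u) (snd v) - anchor (fst v) (snd u) + \<omega> [fst u, fst v])"

definition ext_anchor :: "('g \<Rightarrow> 'a \<Rightarrow> 'a) \<Rightarrow> 'g \<times> 'a \<Rightarrow> 'a \<Rightarrow> 'a" where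
  "ext_anchor anchor u = anchor (fst u)"

definition canonical_form :: "('g \<times> 'a) list \<Rightarrow> 'a::zero" where
  "canonical_form us = (case us of [u] \<Rightarrow> snd u | _ \<Rightarrow> 0)"

definition strict_symmetry ::
  "('g \<Rightarrow> 'g \<Rightarrow> 'g) \<Rightarrow> ('g \<Rightarrow> 'a \<Rightarrow> 'a) \<Rightarrow> ('g list \<Rightarrow> 'a) \<Rightarrow> 'g \<times> 'a::comm_ring_1 \<Rightarrow> bool" where
  "strict_symmetry bracket anchor \<omega> u \<longleftrightarrow>
     lie_derivative (ext_bracket bracket anchor \<omega>) (ext_anchor anchor) u canonical_form = 0"

definition strict_lifts ::
  "('g \<Rightarrow> 'g \<Rightarrow> 'g) \<Rightarrow> ('g \<Rightarrow> 'a \<Rightarrow> 'a) \<Rightarrow> ('g list \<Rightarrow> 'a) \<Rightarrow> 'g \<Rightarrow> ('g \<times> 'a::comm_ring_1) set" where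
  "strict_lifts bracket anchor \<omega> x = {u. fst u = x \<and> strict_symmetry bracket anchor \<omega> u}"

text \<open>
  \<open>S\<close> is an affine space over the \<open>K\<close>-subspace \<open>V\<close>: it is nonempty and the additive group \<open>V\<close>
  acts on it simply transitively.
\<close>

definition affine_space_over ::
  "('k::field \<Rightarrow> 'v::ab_group_add \<Rightarrow> 'v) \<Rightarrow> 'v set \<Rightarrow> ('v \<Rightarrow> 's \<Rightarrow> 's) \<Rightarrow> 's set \<Rightarrow> bool" where
  "affine_space_over scaleK V act S \<longleftrightarrow>
     module.subspace scaleK V \<and> S \<noteq> {} \<and>
     (\<forall>h\<in>V. \<forall>u\<in>S. act h u \<in> S) \<and>
     (\<forall>u\<in>S. act 0 u = u) \<and>
     (\<forall>h\<in>V. \<forall>k\<in>V. \<forall>u\<in>S. act (h + k) u = act h (act k u)) \<and>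
     (\<forall>u\<in>S. \<forall>v\<in>S. \<exists>!h\<in>V. act h u = v)"

end

theory Submission
  imports Defs
begin

text \<open>
  Everything follows from one computation. On the extension, the bracket is built so that
  \<open>d \<eta> = - \<pi>\<^sup>* \<omega>\<close>: the anchor terms of the differential cancel those of the bracket and only the
  cocycle \<open>\<omega>\<close> survives. Since \<open>i\<^sub>u \<eta> = f\<close> for \<open>u = x + f e\<close>, Cartan's formula gives
  \<open>L\<^sub>u \<eta> = d f - i\<^sub>x \<omega>\<close> (pulled back along \<open>\<pi>\<close>), so that \<open>u\<close> is a strict symmetry exactly when
  \<open>i\<^sub>x \<omega> = d f\<close> (lemma \<open>strict_symmetry_iff_potential\<close>): strict lifts of \<open>x\<close> are the same thing
  as potentials of \<open>i\<^sub>x \<omega>\<close>.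

  The three claims then read off from this equation. A potential exists iff \<open>x\<close> is Hamiltonian,
  because \<open>X\<^sub>f\<close> is the unique solution of \<open>i\<^sub>x \<omega> = d f\<close> by nondegeneracy (\<open>ham_iff_potential\<close>).
  If \<open>x\<close> is locally Hamiltonian, then \<open>i\<^sub>x \<omega>\<close> is a cocycle, and having a potential means being the
  coboundary of a \<open>0\<close>-cochain, i.e. having zero class. Finally, two potentials differ by a solution
  of the homogeneous equation \<open>d h = 0\<close>, i.e. by an element of \<open>H\<^sup>0\<close>.
\<close>

section \<open>The differential in low degree\<close>

text \<open>
  A cochain of degree \<open>p\<close> vanishes on lists of any length but \<open>p\<close>. Because the differential
  preserves this, up to the shift in degree, an identity between differentials only has to be
  checked on lists of the right length.
\<close>

lemma differential_vanishes_off_degree: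
  fixes \<beta> :: "'g list \<Rightarrow> 'a::comm_ring_1"
  assumes "\<And>y. anchor y 0 = 0"
    and "\<And>ys. length ys \<noteq> p \<Longrightarrow> \<beta> ys = 0"
    and "length xs \<noteq> Suc p"
  shows "differential bracket anchor \<beta> xs = 0"
proof -
  have "\<beta> (omit i xs) = 0" if "i < length xs" for i
    using that assms(3) by (intro assms(2)) (auto simp: omit_def)
  moreover have "\<beta> (z # omit i (omit j xs)) = 0" if "i < j" "j < length xs" for i j z
    using that assms(3) by (intro assms(2)) (auto simp: omit_def)
  ultimately show ?thesis
    by (simp add: differential_def assms(1))
qed

lemma differential_singleton:
  "differential bracket anchor \<beta> [y] = anchor y (\<beta> [])"
  by (simp add: differential_def omit_def)

lemma differential_pair:
  "differential bracket anchor \<beta> [y, z] =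
     anchor y (\<beta> [z]) - anchor z (\<beta> [y]) - \<beta> [bracket y z]"
  by (simp add: differential_def omit_def numeral_2_eq_2 lessThan_Suc)

lemma differential_const_cochain:
  assumes "\<And>y. anchor y 0 = 0"
  shows "differential bracket anchor (const_cochain a) =
    (\<lambda>xs. case xs of [y] \<Rightarrow> anchor y a | _ \<Rightarrow> 0)"
proof
  fix xs
  show "differential bracket anchor (const_cochain a) xs =
      (case xs of [y] \<Rightarrow> anchor y a | _ \<Rightarrow> 0)"
  proof (cases "length xs = Suc 0")
    case True
    then show ?thesis
      by (auto simp: length_Suc_conv differential_singleton const_cochain_def)
  next
    case False
    have "differential bracket anchor (const_cochain a) xs = 0"
      by (rule differential_vanishes_off_degree[where p = 0])
        (use False assms in \<open>auto simp: const_cochain_def\<close>)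
    with False show ?thesis
      by (auto split: list.split)
  qed
qed

lemma zero_cochains_eq: "cochains scaleG 0 = range const_cochain"
proof
  show "cochains scaleG 0 \<subseteq> range const_cochain"
  proof
    fix \<beta> assume "\<beta> \<in> cochains scaleG 0"
    then have "\<beta> = const_cochain (\<beta> [])"
      by (auto simp: cochains_def const_cochain_def fun_eq_iff)
    then show "\<beta> \<in> range const_cochain" by blast
  qed
  show "range const_cochain \<subseteq> cochains scaleG 0"
    by (auto simp: cochains_def const_cochain_def)
qed

section \<open>The Lie derivative of the canonical form\<close>

text \<open>
  The computation behind the theorem: in the extension \<open>(d \<eta>)(u, v) = - \<omega>(x, y)\<close>, where \<open>x\<close> and
  \<open>y\<close> are the projections of \<open>u\<close> and \<open>v\<close>, while \<open>i\<^sub>u \<eta>\<close> is the function \<open>f\<close>.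
\<close>

lemma lie_derivative_canonical_form:
  fixes anchor :: "'g \<Rightarrow> 'a \<Rightarrow> 'a::comm_ring_1"
  assumes "\<And>y. anchor y 0 = 0"
  shows "lie_derivative (ext_bracket bracket anchor \<omega>) (ext_anchor anchor) (x, f) canonical_form =
    (\<lambda>vs. case vs of [v] \<Rightarrow> anchor (fst v) f - \<omega> [x, fst v] | _ \<Rightarrow> 0)"
proof
  fix vs :: "('g \<times> 'a) list"
  let ?d = "differential (ext_bracket bracket anchor \<omega>) (ext_anchor anchor)"
  have 0: "ext_anchor anchor v 0 = 0" for v
    by (simp add: ext_anchor_def assms)
  have i: "interior_product (x, f) canonical_form = const_cochain f"
    by (auto simp: interior_product_def canonical_form_def const_cochain_def fun_eq_iff
        split: list.split)
  have L: "lie_derivative (ext_bracket bracket anchor \<omega>) (ext_anchor anchor) (x, f)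
        canonical_form vs =
      ?d canonical_form ((x, f) # vs) + (case vs of [v] \<Rightarrow> ext_anchor anchor v f | _ \<Rightarrow> 0)"
    using differential_const_cochain[of "ext_anchor anchor", OF 0]
    unfolding lie_derivative_def i by (simp add: interior_product_def)
  show "lie_derivative (ext_bracket bracket anchor \<omega>) (ext_anchor anchor) (x, f)
      canonical_form vs = (case vs of [v] \<Rightarrow> anchor (fst v) f - \<omega> [x, fst v] | _ \<Rightarrow> 0)"
  proof (cases "length vs = Suc 0")
    case True
    then obtain v where "vs = [v]" by (auto simp: length_Suc_conv)
    then show ?thesis
      unfolding L
      by (simp add: differential_pair canonical_form_def ext_bracket_def ext_anchor_def)
  next
    case False
    have "?d canonical_form ((x, f) # vs) = 0"
      by (rule differential_vanishes_off_degree[where p = 1])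
        (use False 0 in \<open>auto simp: canonical_form_def split: list.split\<close>)
    with False show ?thesis
      unfolding L by (auto split: list.split)
  qed
qed

section \<open>Cohomology classes\<close>

context lrj_algebra
begin

lemma anchor_linear: "Vector_Spaces.linear scaleK scaleK (anchor x)"
  using anchor_Diff1[of x] by (simp add: Diff1_def)

lemma module_hom_anchor: "module_hom scaleK scaleK (anchor x)"
  using anchor_linear by (simp add: module_hom_iff_linear)

lemmas anchor_zero_right = module_hom.zero[OF module_hom_anchor]
lemmas anchor_add_right = module_hom.add[OF module_hom_anchor]
lemmas anchor_diff_right = module_hom.diff[OF module_hom_anchor]
lemmas anchor_scaleK_right = module_hom.scale[OF module_hom_anchor]

lemma differential_diff:
  "differential bracket anchor (\<beta> - \<gamma>) =
     differential bracket anchor \<beta> - differential bracket anchor \<gamma>"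
  by (rule ext)
    (simp add: differential_def anchor_diff_right right_diff_distrib sum_subtractf)

lemma differential_zero: "differential bracket anchor 0 = 0"
  using differential_diff[of 0 0] by simp

lemma module_mult: "module ((*) :: 'a \<Rightarrow> 'a \<Rightarrow> 'a)"
  by unfold_locales (simp_all add: algebra_simps)

lemma module_hom_scaleG_iff:
  "module_hom scaleG (*) \<phi> \<longleftrightarrow>
     (\<forall>x y. \<phi> (x + y) = \<phi> x + \<phi> y) \<and> (\<forall>a x. \<phi> (scaleG a x) = a * \<phi> x)"
  by (simp add: module_hom_iff G.module_axioms module_mult)

lemma cochains_zero: "0 \<in> cochains scaleG p"
  by (simp add: cochains_def module_hom_scaleG_iff)

lemma cochains_diff:
  assumes "\<beta> \<in> cochains scaleG p" "\<gamma> \<in> cochains scaleG p"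
  shows "\<beta> - \<gamma> \<in> cochains scaleG p"
  using assms by (simp add: cochains_def module_hom_scaleG_iff right_diff_distrib)

lemma coboundaries_zero: "0 \<in> coboundaries scaleG bracket anchor p"
  using imageI[OF cochains_zero, of "differential bracket anchor"]
  by (cases p) (auto simp: coboundaries_def differential_zero)

lemma coboundaries_diff:
  assumes "\<beta> \<in> coboundaries scaleG bracket anchor p" "\<gamma> \<in> coboundaries scaleG bracket anchor p"
  shows "\<beta> - \<gamma> \<in> coboundaries scaleG bracket anchor p"
proof (cases p)
  case 0
  then show ?thesis using assms by (simp add: coboundaries_def)
next
  case (Suc q)
  with assms obtain \<beta>' \<gamma>' where "\<beta>' \<in> cochains scaleG q" "\<gamma>' \<in> cochains scaleG q"
    and "\<beta> - \<gamma> = differential bracket anchor (\<beta>' - \<gamma>')"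
    by (auto simp: coboundaries_def differential_diff)
  with Suc show ?thesis
    by (auto simp: coboundaries_def intro: cochains_diff)
qed

lemma zero_in_cocycles: "0 \<in> cocycles scaleG bracket anchor p"
  by (simp add: cocycles_def cochains_zero differential_zero)

lemma equiv_cohomologous:
  "equiv (cocycles scaleG bracket anchor p) (cohomologous scaleG bracket anchor p)"
proof (intro equivI refl_onI symI transI)
  let ?B = "coboundaries scaleG bracket anchor p"
  show "cohomologous scaleG bracket anchor p
      \<subseteq> cocycles scaleG bracket anchor p \<times> cocycles scaleG bracket anchor p"
    by (auto simp: cohomologous_def)
  show "(\<beta>, \<beta>) \<in> cohomologous scaleG bracket anchor p"
    if "\<beta> \<in> cocycles scaleG bracket anchor p" for \<beta>
    using that by (simp add: cohomologous_def coboundaries_zero)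
  have minus: "\<gamma> - \<beta> \<in> ?B" if "\<beta> - \<gamma> \<in> ?B" for \<beta> \<gamma>
    using coboundaries_diff[OF coboundaries_zero that] by simp
  then show "(\<gamma>, \<beta>) \<in> cohomologous scaleG bracket anchor p"
    if "(\<beta>, \<gamma>) \<in> cohomologous scaleG bracket anchor p" for \<beta> \<gamma>
    using that by (simp add: cohomologous_def)
  show "(\<beta>, \<delta>) \<in> cohomologous scaleG bracket anchor p"
    if "(\<beta>, \<gamma>) \<in> cohomologous scaleG bracket anchor p"
      and "(\<gamma>, \<delta>) \<in> cohomologous scaleG bracket anchor p" for \<beta> \<gamma> \<delta>
    using that coboundaries_diff[of "\<beta> - \<gamma>" p "\<delta> - \<gamma>"] minus[of \<gamma> \<delta>]
    by (simp add: cohomologous_def)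
qed

lemma cohomology_class_in_cohomology:
  assumes "\<beta> \<in> cocycles scaleG bracket anchor p"
  shows "cohomology_class scaleG bracket anchor p \<beta> \<in> cohomology scaleG bracket anchor p"
  using assms by (simp add: cohomology_class_def cohomology_def quotientI)

lemma cohomology_class_eq_zero_iff:
  assumes "\<beta> \<in> cocycles scaleG bracket anchor p"
  shows "cohomology_class scaleG bracket anchor p \<beta> = cohomology_class scaleG bracket anchor p 0
    \<longleftrightarrow> \<beta> \<in> coboundaries scaleG bracket anchor p"
  using eq_equiv_class_iff[OF equiv_cohomologous assms zero_in_cocycles] assms zero_in_cocycles
  by (simp add: cohomology_class_def cohomologous_def)

lemma one_coboundaries_eq:
  "coboundaries scaleG bracket anchor 1 =
     range (\<lambda>a. differential bracket anchor (const_cochain a))"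
  by (simp add: coboundaries_def zero_cochains_eq image_image)

lemma differential_const_cochain_in_dual:
  "(\<lambda>y. differential bracket anchor (const_cochain a) [y]) \<in> dual_module scaleG"
  by (simp add: dual_module_def module_hom_scaleG_iff differential_singleton const_cochain_def
      anchor_add anchor_scale)

lemma subspace_H0: "subspace (H0 anchor)"
  by (auto simp: subspace_def H0_def anchor_zero_right anchor_add_right anchor_scaleK_right)

end

section \<open>Potentials of the contracted symplectic form\<close>

context symplectic_lrj_algebra
begin

lemma interior_omega_vanishes: "length ys \<noteq> 1 \<Longrightarrow> interior_product x \<omega> ys = 0"
  using omega_cochain by (auto simp: cochains_def interior_product_def)

lemma interior_omega_eq_differential_iff:
  "interior_product x \<omega> = differential bracket anchor (const_cochain a) \<longleftrightarrow>
     (\<forall>y. \<omega> [x, y] = anchor y a)"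
proof
  assume "interior_product x \<omega> = differential bracket anchor (const_cochain a)"
  then have "interior_product x \<omega> [y] = differential bracket anchor (const_cochain a) [y]" for y
    by simp
  then show "\<forall>y. \<omega> [x, y] = anchor y a"
    by (simp add: interior_product_def differential_singleton const_cochain_def)
next
  assume eq: "\<forall>y. \<omega> [x, y] = anchor y a"
  show "interior_product x \<omega> = differential bracket anchor (const_cochain a)"
  proof
    fix ys
    show "interior_product x \<omega> ys = differential bracket anchor (const_cochain a) ys"
    proof (cases "length ys = 1")
      case True
      then obtain y where "ys = [y]" by (auto simp: length_Suc_conv)
      with eq show ?thesis
        by (simp add: interior_product_def differential_singleton const_cochain_def)
    next
      case False
      then show ?thesis
        using interior_omega_vanishes
        by (auto simp: differential_const_cochain anchor_zero_right split: list.split)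
    qed
  qed
qed

lemma strict_symmetry_iff:
  "strict_symmetry bracket anchor \<omega> (x, f) \<longleftrightarrow> (\<forall>y. \<omega> [x, y] = anchor y f)"
proof
  assume "strict_symmetry bracket anchor \<omega> (x, f)"
  then have L: "(\<lambda>vs. case vs of [v] \<Rightarrow> anchor (fst v) f - \<omega> [x, fst v] | _ \<Rightarrow> 0) =
      (0 :: ('g \<times> 'a) list \<Rightarrow> 'a)"
    unfolding strict_symmetry_def lie_derivative_canonical_form[of anchor, OF anchor_zero_right] .
  \<comment> \<open>Any lift of \<open>y\<close> to the extension could serve as test vector: \<open>L\<^sub>u \<eta>\<close> is basic.\<close>
  show "\<forall>y. \<omega> [x, y] = anchor y f"
    using fun_cong[OF L, of "[(y, 0)]" for y] by simp
next
  assume "\<forall>y. \<omega> [x, y] = anchor y f"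
  then show "strict_symmetry bracket anchor \<omega> (x, f)"
    unfolding strict_symmetry_def lie_derivative_canonical_form[of anchor, OF anchor_zero_right]
    by (auto simp: fun_eq_iff split: list.split)
qed

lemma strict_symmetry_iff_potential:
  "strict_symmetry bracket anchor \<omega> (x, f) \<longleftrightarrow>
     interior_product x \<omega> = differential bracket anchor (const_cochain f)"
  by (simp add: strict_symmetry_iff interior_omega_eq_differential_iff)

text \<open>
  Both halves of the bijectivity of \<open>\<omega>\<^sup>\<flat>\<close> enter: surjectivity onto the dual module applies because
  \<open>d a\<close> is \<open>A\<close>-linear, and injectivity makes the description of \<open>X\<^sub>a\<close> definite.
\<close>

lemma ex1_symplectic_gradient:
  "\<exists>!x. interior_product x \<omega> = differential bracket anchor (const_cochain a)"
proof -
  define \<phi> where "\<phi> = (\<lambda>y. differential bracket anchor (const_cochain a) [y])"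
  have iff: "interior_product x \<omega> = differential bracket anchor (const_cochain a) \<longleftrightarrow>
      flat \<omega> x = \<phi>" for x
    unfolding interior_omega_eq_differential_iff
    by (simp add: \<phi>_def fun_eq_iff flat_def interior_product_def differential_singleton
        const_cochain_def)
  have "\<phi> \<in> range (flat \<omega>)"
    using flat_bij differential_const_cochain_in_dual[of a] by (simp add: bij_betw_def \<phi>_def)
  then obtain x where x: "flat \<omega> x = \<phi>" by blast
  have "z = x" if "flat \<omega> z = \<phi>" for z
    using flat_bij that x by (simp add: bij_betw_def inj_def)
  with x show ?thesis unfolding iff by blast
qed

lemma ham_iff_potential:
  "x \<in> ham bracket anchor \<omega> \<longleftrightarrow>
     (\<exists>a. interior_product x \<omega> = differential bracket anchor (const_cochain a))"
proof -
  have "interior_product (symplectic_gradient bracket anchor \<omega> a) \<omega> =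
      differential bracket anchor (const_cochain a)" for a
    unfolding symplectic_gradient_def by (rule theI'[OF ex1_symplectic_gradient])
  moreover have "x = symplectic_gradient bracket anchor \<omega> a"
    if "interior_product x \<omega> = differential bracket anchor (const_cochain a)" for a
    unfolding symplectic_gradient_def
    by (rule the1_equality[OF ex1_symplectic_gradient that, symmetric])
  ultimately show ?thesis
    unfolding ham_def by (metis rangeI rangeE)
qed

lemma interior_omega_cochain: "interior_product x \<omega> \<in> cochains scaleG 1"
proof -
  have "module_hom scaleG (*) (\<lambda>y. \<omega> ((x # ys)[Suc i := y]))"
    if "length ys = 1" "i < 1" for ys i
  proof -
    have "length (x # ys) = 2" "Suc i < 2" using that by auto
    then show ?thesis using omega_cochain unfolding cochains_def by blast
  qed
  then show ?thesis
    using interior_omega_vanishes[of _ x] by (simp add: cochains_def interior_product_def)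
qed

text \<open>Since \<open>d \<omega> = 0\<close>, Cartan's formula reduces \<open>L\<^sub>x \<omega>\<close> to \<open>d (i\<^sub>x \<omega>)\<close>.\<close>

lemma ham_loc_iff_cocycle:
  "x \<in> ham_loc bracket anchor \<omega> \<longleftrightarrow>
     interior_product x \<omega> \<in> cocycles scaleG bracket anchor 1"
proof -
  have "interior_product x (differential bracket anchor \<omega>) = 0"
    by (simp add: omega_closed interior_product_def fun_eq_iff)
  then show ?thesis
    using interior_omega_cochain[of x]
    by (simp add: ham_loc_def lie_derivative_def cocycles_def)
qed

text \<open>
  The equation \<open>\<omega>(x, y) = \<rho>(y)(f)\<close> for a strict lift \<open>x + f e\<close> is an inhomogeneous linear system in
  \<open>f\<close> whose homogeneous part defines \<open>H\<^sup>0\<close>.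
\<close>

lemma affine_space_strict_lifts:
  assumes "strict_lifts bracket anchor \<omega> x \<noteq> {}"
  shows "affine_space_over scaleK (H0 anchor)
    (\<lambda>h u. u + ext_scale scaleG h ext_generator) (strict_lifts bracket anchor \<omega> x)"
proof -
  have act: "u + ext_scale scaleG h ext_generator = (fst u, snd u + h)" for u :: "'g \<times> 'a" and h
    by (simp add: ext_scale_def ext_generator_def prod_eq_iff)
  have lifts: "(z, f) \<in> strict_lifts bracket anchor \<omega> x \<longleftrightarrow>
      z = x \<and> (\<forall>y. \<omega> [x, y] = anchor y f)" for z f
    by (auto simp: strict_lifts_def strict_symmetry_iff)
  have unique: "\<exists>!h. h \<in> H0 anchor \<and> (fst u, snd u + h) = v"
    if "u \<in> strict_lifts bracket anchor \<omega> x" "v \<in> strict_lifts bracket anchor \<omega> x" for u v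
  proof (rule ex1I[of _ "snd v - snd u"])
    show "snd v - snd u \<in> H0 anchor \<and> (fst u, snd u + (snd v - snd u)) = v"
      using that by (cases u; cases v) (simp add: lifts H0_def anchor_diff_right)
  qed auto
  show ?thesis
    unfolding affine_space_over_def act
  proof (intro conjI ballI)
    show "(fst u, snd u + h) \<in> strict_lifts bracket anchor \<omega> x"
      if "h \<in> H0 anchor" "u \<in> strict_lifts bracket anchor \<omega> x" for h u
      using that by (cases u) (simp add: lifts H0_def anchor_add_right)
  qed (use assms subspace_H0 unique in \<open>simp_all add: ac_simps\<close>)
qed

end

section \<open>Strict symmetries and Hamiltonian elements\<close>

theorem theorem7p1:
  fixes scaleK :: "'k::field_char_0 \<Rightarrow> 'a::comm_ring_1 \<Rightarrow> 'a"
    and scaleG :: "'a \<Rightarrow> 'g::ab_group_add \<Rightarrow> 'g"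
    and bracket :: "'g \<Rightarrow> 'g \<Rightarrow> 'g"
    and anchor :: "'g \<Rightarrow> 'a \<Rightarrow> 'a"
    and \<omega> :: "'g list \<Rightarrow> 'a"
    and x :: 'g
  assumes "symplectic_lrj_algebra scaleK scaleG bracket anchor \<omega>"
  shows "((\<exists>f. strict_symmetry bracket anchor \<omega> (x, f)) \<longleftrightarrow> x \<in> ham bracket anchor \<omega>) \<and>
    (x \<in> ham_loc bracket anchor \<omega> \<longrightarrow>
      cohomology_class scaleG bracket anchor 1 (interior_product x \<omega>) \<in> cohomology scaleG bracket anchor 1 \<and>
      ((\<exists>f. strict_symmetry bracket anchor \<omega> (x, f)) \<longleftrightarrow>
        cohomology_class scaleG bracket anchor 1 (interior_product x \<omega>) =
        cohomology_class scaleG bracket anchor 1 0)) \<and>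
    (strict_lifts bracket anchor \<omega> x \<noteq> {} \<longrightarrow>
      affine_space_over scaleK (H0 anchor)
        (\<lambda>h u. u + ext_scale scaleG h ext_generator) (strict_lifts bracket anchor \<omega> x))"
proof -
  interpret symplectic_lrj_algebra scaleK scaleG bracket anchor \<omega> by fact
  have potential: "(\<exists>f. strict_symmetry bracket anchor \<omega> (x, f)) \<longleftrightarrow>
      interior_product x \<omega> \<in> coboundaries scaleG bracket anchor 1"
    unfolding strict_symmetry_iff_potential one_coboundaries_eq by blast
  have "(\<exists>f. strict_symmetry bracket anchor \<omega> (x, f)) \<longleftrightarrow> x \<in> ham bracket anchor \<omega>"
    by (simp add: strict_symmetry_iff_potential ham_iff_potential)
  then show ?thesis
    using potential cohomology_class_in_cohomology[of "interior_product x \<omega>" 1]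
      cohomology_class_eq_zero_iff[of "interior_product x \<omega>" 1] affine_space_strict_lifts
    by (simp add: ham_loc_iff_cocycle)
qed

end
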